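(* Let $G$ be a finite simple connected graph of order $n\ge 2$ with maximum degree $\Delta$, minimum degree $\delta$, and Sombor index $SO(G)$. Then $$\frac{1}{\Delta}\, SO(G) \leq HSO(G) \leq \frac{1}{\delta}\, SO(G).$$ Moreover, the left equality holds if and only if $G$ is a regular graph, and the right equality holds if and only if $G$ is a regular graph or $G\in \Gamma$.
   Context: All graphs are finite, simple and connected. For a graph $G$ with vertices $v_1,\dots,v_n$ and edge set $E(G)$, $d_i$ denotes the degree of $v_i$. The Hyperbolic Sombor index is $HSO(G)=\sum_{v_iv_j\in E(G)}\frac{\sqrt{d_i^2+d_j^2}}{\min\{d_i,d_j\}}$, and the Sombor index is $SO(G)=\sum_{v_iv_j\in E(G)}\sqrt{d_i^2+d_j^2}$. A graph is regular if its maximum and minimum degrees coincide. $\Gamma$ denotes the class of connected graphs $H$ of order $n$ with minimum degree $\delta$ such that the vertex set can be partitioned as $V(H)=U\cup W$, $U\cap W=\emptyset$, where: there are no edges of $H$ between two vertices of $U$ (the induced subgraph $H[U]$ is an empty graph); edges may or may not exist between vertices of $W$; and every vertex $v_i\in W$ has degree $d_i=\delta$. *)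

theory Defs
  imports Complex_Main "Graph_Theory.Graph_Theory"
begin

text \<open>
  A finite simple graph is a finite, loop-free, symmetric digraph without parallel arcs
  (locale \<^locale>\<open>graph\<close>): each undirected edge is represented by a pair of
  opposite arcs. Hence the degree of a vertex is its out-degree, whereas sums over edges
  must range over the unordered pairs of end vertices and not over the arcs, which would
  count every edge twice.
\<close>

abbreviation degree :: "('a, 'b) pre_digraph \<Rightarrow> 'a \<Rightarrow> nat" where
  "degree G v \<equiv> out_degree G v"

definition edges :: "('a, 'b) pre_digraph \<Rightarrow> 'a set set" where
  "edges G = {{u, v} | u v. u \<rightarrow>\<^bsub>G\<^esub> v}"

definition max_degree :: "('a, 'b) pre_digraph \<Rightarrow> nat" where
  "max_degree G = Max (degree G ` verts G)"

definition min_degree :: "('a, 'b) pre_digraph \<Rightarrow> nat" where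
  "min_degree G = Min (degree G ` verts G)"

definition regular :: "('a, 'b) pre_digraph \<Rightarrow> bool" where
  "regular G \<longleftrightarrow> max_degree G = min_degree G"

definition sombor :: "('a, 'b) pre_digraph \<Rightarrow> real" where
  "sombor G = (\<Sum>e\<in>edges G. sqrt (\<Sum>v\<in>e. (real (degree G v))\<^sup>2))"

definition hyperbolic_sombor :: "('a, 'b) pre_digraph \<Rightarrow> real" where
  "hyperbolic_sombor G =
    (\<Sum>e\<in>edges G. sqrt (\<Sum>v\<in>e. (real (degree G v))\<^sup>2) / real (Min (degree G ` e)))"

text \<open>
  On an edge, i.e. a set of two distinct vertices, the summands are the usual
  symmetric expressions in the degrees of the two end vertices.
\<close>

lemma (in graph) edge_terms:
  assumes "u \<rightarrow> v"
  shows "(\<Sum>w\<in>{u, v}. (real (degree G w))\<^sup>2) = (real (degree G u))\<^sup>2 + (real (degree G v))\<^sup>2"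
    and "Min (degree G ` {u, v}) = min (degree G u) (degree G v)"
proof -
  have "u \<noteq> v" using adj_not_same assms by blast
  then show "(\<Sum>w\<in>{u, v}. (real (degree G w))\<^sup>2) = (real (degree G u))\<^sup>2 + (real (degree G v))\<^sup>2"
    by simp
qed simp

text \<open>
  \<^const>\<open>Digraph_Component.connected\<close> is written qualified because of the topological
  notion of the same name. The parts \<open>U\<close> and \<open>W\<close> may be empty.
\<close>

definition Gamma :: "nat \<Rightarrow> nat \<Rightarrow> ('a, 'b) pre_digraph set" where
  "Gamma n \<delta> = {H. graph H \<and> Digraph_Component.connected H \<and>
     card (verts H) = n \<and> min_degree H = \<delta> \<and>
     (\<exists>U W. verts H = U \<union> W \<and> U \<inter> W = {} \<and>
        arcs (H \<restriction> U) = {} \<and>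
        (\<forall>v\<in>W. degree H v = \<delta>))}"

end

theory Submission
  imports Defs
begin

text \<open>
  The Sombor index and the Hyperbolic Sombor index add up the same positive edge weights
  \<open>sqrt (d\<^sub>u\<^sup>2 + d\<^sub>v\<^sup>2)\<close>; the latter divides each of them by the smaller end degree
  \<open>min d\<^sub>u d\<^sub>v\<close>, which lies between \<open>\<delta>\<close> and \<open>\<Delta>\<close>. Comparing the sums edge by edge gives both
  inequalities, and since the weights are positive, equality of the sums forces equality on
  every edge (\<open>sum_divide_eq_iff_upper\<close> and \<open>sum_divide_eq_iff_lower\<close>). Connectedness of a graph
  with at least two vertices enters by excluding isolated vertices: this makes \<open>\<delta>\<close> positive,
  and it lets the edges see every vertex.

  What remains is to say for which graphs the smaller end degree is constant on the edges.
  If it is always \<open>\<Delta>\<close>, then both ends of every edge have degree \<open>\<Delta>\<close>, so every vertex has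
  (\<open>all_edges_Min_eq_max_degree_iff\<close>). If it is always \<open>\<delta>\<close>, then no edge joins two vertices of
  degree larger than \<open>\<delta>\<close>, so these form the independent part \<open>U\<close> in the definition of \<open>\<Gamma>\<close>, with
  \<open>W\<close> the set of vertices of degree \<open>\<delta>\<close>; conversely every edge then meets \<open>W\<close>
  (\<open>all_edges_Min_eq_min_degree_iff\<close>). A regular graph is the case \<open>U = {}\<close>.
\<close>

section \<open>Sums divided by bounded quantities\<close>

lemma sum_eq_iff_if_le:
  fixes f g :: "'c \<Rightarrow> 'd::ordered_cancel_comm_monoid_add"
  assumes "finite A" "\<And>x. x \<in> A \<Longrightarrow> f x \<le> g x"
  shows "sum f A = sum g A \<longleftrightarrow> (\<forall>x\<in>A. f x = g x)"
  using sum_mono_inv[of f A g] assms by auto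

context
  fixes f m :: "'c \<Rightarrow> real" and A :: "'c set" and c :: real
  assumes fin: "finite A"
    and f_pos: "\<And>x. x \<in> A \<Longrightarrow> 0 < f x"
    and m_pos: "\<And>x. x \<in> A \<Longrightarrow> 0 < m x"
    and c_pos: "0 < c"
begin

lemma divide_eq_iff_divisor_eq: "x \<in> A \<Longrightarrow> f x / c = f x / m x \<longleftrightarrow> m x = c"
  using f_pos[of x] m_pos[of x] c_pos by (auto simp: divide_simps)

lemma
  assumes "\<And>x. x \<in> A \<Longrightarrow> m x \<le> c"
  shows sum_divide_le_upper: "sum f A / c \<le> (\<Sum>x\<in>A. f x / m x)"
    and sum_divide_eq_iff_upper: "sum f A / c = (\<Sum>x\<in>A. f x / m x) \<longleftrightarrow> (\<forall>x\<in>A. m x = c)"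
proof -
  have le: "f x / c \<le> f x / m x" if "x \<in> A" for x
    using that assms f_pos m_pos by (intro divide_left_mono) (auto simp: less_imp_le c_pos)
  show "sum f A / c \<le> (\<Sum>x\<in>A. f x / m x)"
    unfolding sum_divide_distrib by (rule sum_mono) (rule le)
  show "sum f A / c = (\<Sum>x\<in>A. f x / m x) \<longleftrightarrow> (\<forall>x\<in>A. m x = c)"
    unfolding sum_divide_distrib
    using sum_eq_iff_if_le[of A "\<lambda>x. f x / c" "\<lambda>x. f x / m x", OF fin le]
      divide_eq_iff_divisor_eq by blast
qed

lemma
  assumes "\<And>x. x \<in> A \<Longrightarrow> c \<le> m x"
  shows sum_divide_le_lower: "(\<Sum>x\<in>A. f x / m x) \<le> sum f A / c"
    and sum_divide_eq_iff_lower: "(\<Sum>x\<in>A. f x / m x) = sum f A / c \<longleftrightarrow> (\<forall>x\<in>A. m x = c)"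
proof -
  have le: "f x / m x \<le> f x / c" if "x \<in> A" for x
    using that assms f_pos m_pos by (intro divide_left_mono) (auto simp: less_imp_le c_pos)
  show "(\<Sum>x\<in>A. f x / m x) \<le> sum f A / c"
    unfolding sum_divide_distrib by (rule sum_mono) (rule le)
  show "(\<Sum>x\<in>A. f x / m x) = sum f A / c \<longleftrightarrow> (\<forall>x\<in>A. m x = c)"
    unfolding sum_divide_distrib
    using sum_eq_iff_if_le[of A "\<lambda>x. f x / m x" "\<lambda>x. f x / c", OF fin le]
      divide_eq_iff_divisor_eq by metis
qed

end

section \<open>Degrees and edges\<close>

context graph
begin

lemma finite_edges: "finite (edges G)"
proof (rule finite_subset)
  show "edges G \<subseteq> Pow (verts G)"
    by (auto simp: edges_def dest: adj_in_verts)
qed simp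

lemma edgesE:
  assumes "e \<in> edges G"
  obtains u v where "e = {u, v}" "u \<rightarrow> v" "u \<in> verts G" "v \<in> verts G"
  using assms by (auto simp: edges_def dest: adj_in_verts)

lemma min_degree_le: "v \<in> verts G \<Longrightarrow> min_degree G \<le> degree G v"
  by (simp add: min_degree_def)

lemma degree_le_max_degree: "v \<in> verts G \<Longrightarrow> degree G v \<le> max_degree G"
  by (simp add: max_degree_def)

lemma regular_iff:
  assumes "verts G \<noteq> {}"
  shows "regular G \<longleftrightarrow> (\<forall>v\<in>verts G. degree G v = max_degree G)"
proof
  assume "regular G"
  then show "\<forall>v\<in>verts G. degree G v = max_degree G"
    using min_degree_le degree_le_max_degree by (simp add: regular_def antisym)
next
  assume *: "\<forall>v\<in>verts G. degree G v = max_degree G"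
  have "min_degree G \<in> degree G ` verts G"
    unfolding min_degree_def using assms by (intro Min_in) auto
  with * show "regular G" by (auto simp: regular_def)
qed

lemma degree_pos_iff: "0 < degree G v \<longleftrightarrow> (\<exists>w. v \<rightarrow> w)"
  by (auto simp: out_degree_def out_arcs_def card_gt_0_iff arcs_ends_conv)

lemma connected_imp_adj:
  assumes "Digraph_Component.connected G" "card (verts G) \<ge> 2" "v \<in> verts G"
  shows "\<exists>w. v \<rightarrow> w"
proof -
  have "\<not> verts G \<subseteq> {v}"
    using assms(2) card_mono[of "{v}" "verts G"] by auto
  then obtain w where w: "w \<in> verts G" "w \<noteq> v" by blast
  have "v \<rightarrow>\<^sup>*\<^bsub>mk_symmetric G\<^esub> w"
    using assms(1,3) w(1) by (auto simp: connected_def strongly_connected_def)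
  then have "v \<rightarrow>\<^sup>* w"
    using reachable_mk_symmetric_eq[OF sym_arcs] by blast
  then show ?thesis
    by (cases rule: converse_reachable_cases) (use w(2) in auto)
qed

lemma min_degree_le_Min_edge:
  assumes "e \<in> edges G"
  shows "min_degree G \<le> Min (degree G ` e)"
  using assms by (auto elim!: edgesE simp: min_degree_le)

lemma Min_edge_le_max_degree:
  assumes "e \<in> edges G"
  shows "Min (degree G ` e) \<le> max_degree G"
  using assms by (auto elim!: edgesE simp: min_le_iff_disj degree_le_max_degree)

lemma edge_weight_pos:
  assumes "e \<in> edges G"
  shows "0 < sqrt (\<Sum>v\<in>e. (real (degree G v))\<^sup>2)"
proof -
  obtain u v where e: "e = {u, v}" "u \<rightarrow> v" using assms by (rule edgesE)
  have "0 < degree G u" using e(2) degree_pos_iff by blast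
  then show ?thesis
    unfolding e(1) edge_terms(1)[OF e(2)] by (simp add: add_pos_nonneg)
qed

section \<open>Graphs whose smaller end degree is the same on all edges\<close>

text \<open>
  An edge whose smaller end degree is the largest possible one has both its ends of that
  degree. Since every vertex lies on an edge, no vertex escapes the conclusion.
\<close>

lemma all_edges_Min_eq_max_degree_iff:
  assumes "verts G \<noteq> {}" and adj: "\<And>v. v \<in> verts G \<Longrightarrow> \<exists>w. v \<rightarrow> w"
  shows "(\<forall>e\<in>edges G. Min (degree G ` e) = max_degree G) \<longleftrightarrow> regular G"
proof
  assume *: "\<forall>e\<in>edges G. Min (degree G ` e) = max_degree G"
  have "degree G v = max_degree G" if v: "v \<in> verts G" for v
  proof -
    obtain w where w: "v \<rightarrow> w" using adj[OF v] by blast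
    then have "{v, w} \<in> edges G" by (auto simp: edges_def)
    with * have "min (degree G v) (degree G w) = max_degree G"
      using edge_terms(2)[OF w] by metis
    with degree_le_max_degree[OF v] show ?thesis by simp
  qed
  with assms(1) show "regular G" by (simp add: regular_iff)
next
  assume "regular G"
  with assms(1) show "\<forall>e\<in>edges G. Min (degree G ` e) = max_degree G"
    by (auto elim!: edgesE simp: regular_iff)
qed

text \<open>
  The witness for \<open>U\<close> is the set of all vertices of degree larger than \<open>\<delta>\<close>: an edge inside it
  would have its smaller end degree larger than \<open>\<delta>\<close>.
\<close>

lemma all_edges_Min_eq_min_degree_iff:
  "(\<forall>e\<in>edges G. Min (degree G ` e) = min_degree G) \<longleftrightarrow>
    (\<exists>U W. verts G = U \<union> W \<and> U \<inter> W = {} \<and> arcs (G \<restriction> U) = {} \<and>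
      (\<forall>v\<in>W. degree G v = min_degree G))"
  (is "?L \<longleftrightarrow> ?R")
proof
  assume L: ?L
  let ?W = "{v \<in> verts G. degree G v = min_degree G}"
  have "a \<notin> arcs (G \<restriction> (verts G - ?W))" for a
  proof
    assume "a \<in> arcs (G \<restriction> (verts G - ?W))"
    then have a: "a \<in> arcs G" "tail G a \<notin> ?W" "head G a \<notin> ?W" by auto
    then have adj: "tail G a \<rightarrow> head G a" by (auto simp: arcs_ends_conv)
    then have "{tail G a, head G a} \<in> edges G" by (auto simp: edges_def)
    with L have "min (degree G (tail G a)) (degree G (head G a)) = min_degree G"
      using edge_terms(2)[OF adj] by metis
    with a show False by (auto simp: min_def split: if_splits)
  qed
  then show ?R by (intro exI[of _ "verts G - ?W"] exI[of _ ?W]) blast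
next
  assume ?R
  then obtain U W where UW: "verts G = U \<union> W" "arcs (G \<restriction> U) = {}"
    and W: "\<And>v. v \<in> W \<Longrightarrow> degree G v = min_degree G" by blast
  show ?L
  proof
    fix e assume "e \<in> edges G"
    then obtain u v where e: "e = {u, v}" "u \<rightarrow> v" "u \<in> verts G" "v \<in> verts G"
      by (rule edgesE)
    have "u \<in> W \<or> v \<in> W"
      using e(2-4) UW by (auto simp: arcs_ends_conv)
    then show "Min (degree G ` e) = min_degree G"
      using W min_degree_le[OF e(3)] min_degree_le[OF e(4)] e(1) by (auto simp: min_def)
  qed
qed

lemma mem_Gamma_iff:
  assumes "Digraph_Component.connected G"
  shows "G \<in> Gamma (card (verts G)) (min_degree G) \<longleftrightarrow>
    (\<forall>e\<in>edges G. Min (degree G ` e) = min_degree G)"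
  unfolding all_edges_Min_eq_min_degree_iff Gamma_def using assms graph_axioms by simp

lemma regular_imp_Min_edge_eq_min_degree:
  assumes "regular G" "e \<in> edges G"
  shows "Min (degree G ` e) = min_degree G"
  using assms min_degree_le_Min_edge Min_edge_le_max_degree
  by (fastforce simp: regular_def intro: antisym)

end

section \<open>Comparison of the two indices\<close>

theorem theorem2p1:
  fixes G :: "('a, 'b) pre_digraph" and n \<Delta> \<delta> :: nat
  assumes "graph G" and "Digraph_Component.connected G"
    and "card (verts G) = n" and "n \<ge> 2"
    and "max_degree G = \<Delta>" and "min_degree G = \<delta>"
  shows "1 / real \<Delta> * sombor G \<le> hyperbolic_sombor G
    \<and> hyperbolic_sombor G \<le> 1 / real \<delta> * sombor G
    \<and> (1 / real \<Delta> * sombor G = hyperbolic_sombor G \<longleftrightarrow> regular G)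
    \<and> (hyperbolic_sombor G = 1 / real \<delta> * sombor G \<longleftrightarrow> regular G \<or> G \<in> Gamma n \<delta>)"
proof -
  interpret graph G by fact
  let ?f = "\<lambda>e. sqrt (\<Sum>v\<in>e. (real (degree G v))\<^sup>2)"
  let ?m = "\<lambda>e. real (Min (degree G ` e))"
  have adj: "\<exists>w. v \<rightarrow>\<^bsub>G\<^esub> w" if "v \<in> verts G" for v
    using connected_imp_adj assms(2-4) that by blast
  have ne: "verts G \<noteq> {}" using assms(3,4) by auto
  have \<delta>_pos: "0 < real \<delta>"
  proof -
    have "\<delta> \<in> degree G ` verts G"
      unfolding assms(6)[symmetric] min_degree_def using ne by (intro Min_in) auto
    with adj degree_pos_iff show ?thesis by auto
  qed
  have low: "real \<delta> \<le> ?m e" and up: "?m e \<le> real \<Delta>" if "e \<in> edges G" for e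
    using min_degree_le_Min_edge[OF that] Min_edge_le_max_degree[OF that] assms(5,6) by simp_all
  have m_pos: "0 < ?m e" if "e \<in> edges G" for e
    using low[OF that] \<delta>_pos by linarith
  have \<Delta>_pos: "0 < real \<Delta>"
    using ne min_degree_le degree_le_max_degree assms(5,6) \<delta>_pos by fastforce
  have upper: "1 / real \<Delta> * sombor G \<le> hyperbolic_sombor G"
    and upper_eq: "1 / real \<Delta> * sombor G = hyperbolic_sombor G \<longleftrightarrow> (\<forall>e\<in>edges G. ?m e = real \<Delta>)"
    using sum_divide_le_upper[of "edges G" ?f ?m "real \<Delta>", OF finite_edges edge_weight_pos m_pos \<Delta>_pos up]
      sum_divide_eq_iff_upper[of "edges G" ?f ?m "real \<Delta>", OF finite_edges edge_weight_pos m_pos \<Delta>_pos up]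
    unfolding sombor_def hyperbolic_sombor_def by simp_all
  have lower: "hyperbolic_sombor G \<le> 1 / real \<delta> * sombor G"
    and lower_eq: "hyperbolic_sombor G = 1 / real \<delta> * sombor G \<longleftrightarrow> (\<forall>e\<in>edges G. ?m e = real \<delta>)"
    using sum_divide_le_lower[of "edges G" ?f ?m "real \<delta>", OF finite_edges edge_weight_pos m_pos \<delta>_pos low]
      sum_divide_eq_iff_lower[of "edges G" ?f ?m "real \<delta>", OF finite_edges edge_weight_pos m_pos \<delta>_pos low]
    unfolding sombor_def hyperbolic_sombor_def by simp_all
  have "(\<forall>e\<in>edges G. ?m e = real \<Delta>) \<longleftrightarrow> regular G"
    using all_edges_Min_eq_max_degree_iff[OF ne adj] assms(5) by simp
  moreover have "(\<forall>e\<in>edges G. ?m e = real \<delta>) \<longleftrightarrow> regular G \<or> G \<in> Gamma n \<delta>"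
    using mem_Gamma_iff[OF assms(2)] regular_imp_Min_edge_eq_min_degree assms(3,6) by auto
  ultimately show ?thesis
    using upper upper_eq lower lower_eq by simp
qed

end
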